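(* Let $\varepsilon>0$ and $c>0$. Let $K\in\mathbb N_0$ and $T>0$. For each integer $N\ge 2$ let $\{\phi^{i}_t=\phi^{i,(N)}_t : i=0,\dots,N-1,\ 0\le t\le T\}$ be the solution of the finite periodic Riccati system of size $N$ (see context), and let $\{\varphi^{i}_t : i\in\mathbb N_0,\ 0\le t\le T\}$ be the solution of the infinite Riccati system (see context). Then $$\lim_{N\to\infty}\ \sup_{0\le i\le K}\ \sup_{0\le t\le T}\bigl|\phi^{i,(N)}_t-\varphi^i_t\bigr|=0 .$$
   Context: $\mathbb N_0=\{0,1,2,\dots\}$. Superscripts on $\phi,\varphi,\varepsilon$ are indices, not powers; a dot denotes $\frac{d}{dt}$. Put $\varepsilon^0:=\varepsilon$, $\varepsilon^1:=-\varepsilon$, $\varepsilon^i:=0$ for $i\ge 2$. Infinite Riccati system: real-valued functions $\varphi^i_t$, $i\in\mathbb N_0$, $0\le t\le T$, with $$\dot\varphi^i_t=\sum_{j=0}^{i}\varphi^j_t\,\varphi^{i-j}_t-\varepsilon^i,\qquad \varphi^0_T=c,\quad \varphi^1_T=-c,\quad \varphi^i_T=0\ (i\ge 2).$$ It has a unique solution on $[0,T]$. Finite periodic Riccati system of size $N\ge 2$: real-valued functions $\phi^i_t$, $i=0,\dots,N-1$, $0\le t\le T$, extended to all $i\in\mathbb Z$ by periodicity $\phi^{i+N}_t=\phi^i_t$, with $$\dot\phi^i_t=\sum_{j=0}^{N-1}\phi^j_t\,\phi^{N+i-j}_t-\varepsilon^i,\qquad \phi^0_T=c,\quad \phi^1_T=-c,\quad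 \phi^i_T=0\ (2\le i\le N-1).$$ It has a unique solution on $[0,T]$, which depends on $N$; this is indicated by writing $\phi^{i,(N)}_t$. The limit is taken over $N>K$. *)

theory Defs
  imports "HOL-Analysis.Analysis"
begin

definition eps_seq :: "real \<Rightarrow> nat \<Rightarrow> real" where
  "eps_seq \<epsilon> i = (if i = 0 then \<epsilon> else if i = 1 then - \<epsilon> else 0)"

text \<open>The derivatives at the endpoints of the time interval are one-sided; values of the functions
  outside the interval are irrelevant.\<close>

definition infinite_riccati_solution ::
    "real \<Rightarrow> real \<Rightarrow> real \<Rightarrow> (nat \<Rightarrow> real \<Rightarrow> real) \<Rightarrow> bool" where
  "infinite_riccati_solution \<epsilon> c T \<psi> \<longleftrightarrow>
     (\<forall>i. \<forall>t\<in>{0..T}. (\<psi> i has_real_derivative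
        (\<Sum>j=0..i. \<psi> j t * \<psi> (i - j) t) - eps_seq \<epsilon> i) (at t within {0..T})) \<and>
     \<psi> 0 T = c \<and> \<psi> 1 T = - c \<and> (\<forall>i\<ge>2. \<psi> i T = 0)"

text \<open>The index set is extended from \<open>0, ..., N - 1\<close> to all integers by periodicity.\<close>

definition periodic_riccati_solution ::
    "nat \<Rightarrow> real \<Rightarrow> real \<Rightarrow> real \<Rightarrow> (int \<Rightarrow> real \<Rightarrow> real) \<Rightarrow> bool" where
  "periodic_riccati_solution N \<epsilon> c T \<phi> \<longleftrightarrow>
     (\<forall>i. \<forall>t\<in>{0..T}. \<phi> (i + int N) t = \<phi> i t) \<and>
     (\<forall>i<N. \<forall>t\<in>{0..T}. (\<phi> (int i) has_real_derivative
        (\<Sum>j=0..<N. \<phi> (int j) t * \<phi> (int N + int i - int j) t) - eps_seq \<epsilon> i)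
          (at t within {0..T})) \<and>
     \<phi> 0 T = c \<and> \<phi> 1 T = - c \<and> (\<forall>i\<in>{2..<N}. \<phi> (int i) T = 0)"

end

theory Submission
  imports Defs "HOL-Real_Asymp.Real_Asymp"
begin

text \<open>
  Going backwards from time \<open>T\<close>, barrier arguments show \<open>\<psi>\<^sub>0 > 0\<close> and \<open>\<psi>\<^sub>i \<le> 0\<close> for \<open>i \<ge> 1\<close>.
  The generating function \<open>\<Sum>\<^sub>i r\<^sup>i \<psi>\<^sub>i\<close> formally solves the scalar equation
  \<open>y' = y\<^sup>2 + \<epsilon> (r - 1)\<close>, \<open>y(T) = - c (r - 1)\<close>, whose solution does not blow up on \<open>[0, T]\<close> when
  \<open>r > 1\<close> is close to \<open>1\<close>. By the signs, this bounds \<open>\<Sum>\<^sub>i r\<^sup>i \<bar>\<psi>\<^sub>i\<bar>\<close> uniformly in time, so that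
  \<open>\<psi>\<^sub>i\<close> decays geometrically in \<open>i\<close>. Hence \<open>\<psi>\<^sub>0, \<dots>, \<psi>\<^bsub>N-1\<^esub>\<close> solves the periodic system up to an
  error of order \<open>N r\<^bsup>-N\<^esup>\<close>, and a barrier argument in the supremum norm, whose exponential rate
  depends only on the \<open>\<ell>\<^sup>1\<close> norm of \<open>\<psi>\<close>, bounds the distance to the periodic solution by \<open>1 / N\<close>.
\<close>

section \<open>Barrier principle backwards in time\<close>

text \<open>Consider the last time at which some component is nonnegative. It lies before
  \<open>T\<close>, all components are at most zero there, and one equals zero; its positive
  derivative would make it positive just afterwards. Finiteness of \<open>I\<close> makes the set of
  such times closed, so that the last one exists.\<close>

lemma backward_barrier:
  fixes f f' :: "'k \<Rightarrow> real \<Rightarrow> real"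
  assumes fin: "finite I"
    and der: "\<And>k t. k \<in> I \<Longrightarrow> t \<in> {0..T} \<Longrightarrow> (f k has_real_derivative f' k t) (at t within {0..T})"
    and fT: "\<And>k. k \<in> I \<Longrightarrow> f k T < 0"
    and touch: "\<And>k t. k \<in> I \<Longrightarrow> t \<in> {0..T} \<Longrightarrow> (\<And>j. j \<in> I \<Longrightarrow> f j t \<le> 0) \<Longrightarrow> f k t = 0 \<Longrightarrow> f' k t > 0"
    and k: "k \<in> I" and t: "t \<in> {0..T}"
  shows "f k t < 0"
proof (rule ccontr)
  assume neg: "\<not> f k t < 0"
  have cont: "continuous_on {0..T} (f j)" if "j \<in> I" for j
    using der[OF that] DERIV_continuous_on by blast
  define S where "S = (\<Union>j\<in>I. {s \<in> {0..T}. 0 \<le> f j s})"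
  have "compact {s \<in> {0..T}. 0 \<le> f j s}" if "j \<in> I" for j
  proof -
    have "closed {s \<in> {0..T}. 0 \<le> f j s}"
      using continuous_closed_preimage[OF cont[OF that], of "{0..}"]
      by (simp add: vimage_def Int_def)
    moreover have "bounded {s \<in> {0..T}. 0 \<le> f j s}"
      by (rule bounded_subset[of "{0..T}"]) auto
    ultimately show ?thesis by (simp add: compact_eq_bounded_closed)
  qed
  then have "compact S" unfolding S_def using fin by blast
  moreover have "t \<in> S" unfolding S_def using neg k t by (intro UN_I[of k]) auto
  ultimately obtain s where s: "s \<in> S" and max: "\<And>x. x \<in> S \<Longrightarrow> x \<le> s"
    using compact_attains_sup[of S] by auto
  from s obtain m where m: "m \<in> I" and s0T: "s \<in> {0..T}" and fm: "0 \<le> f m s"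
    by (auto simp: S_def)
  have "s \<noteq> T" using fT[OF m] fm by auto
  with s0T have sT: "s < T" by simp
  have below: "f j x < 0" if "j \<in> I" "s < x" "x \<le> T" for j x
    using max[of x] that s0T by (force simp: S_def)
  \<comment> \<open>A positive value at \<open>s\<close> would force, by the intermediate value
    theorem on \<open>{s..T}\<close>, a zero later than the last time \<open>s\<close>.\<close>
  have le: "f j s \<le> 0" if j: "j \<in> I" for j
  proof (rule ccontr)
    assume "\<not> f j s \<le> 0"
    moreover have "continuous_on {s..T} (f j)"
      by (rule continuous_on_subset[OF cont[OF j]]) (use s0T in auto)
    ultimately obtain x where "s \<le> x" "x \<le> T" "f j x = 0"
      using IVT2'[of "f j" T 0 s] fT[OF j] sT by auto
    with below[OF j, of x] \<open>\<not> f j s \<le> 0\<close> show False by (cases "s = x") auto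
  qed
  have "f m s = 0" using le[OF m] fm by simp
  with touch[OF m s0T le] have "0 < f' m s" by simp
  then obtain d where d: "d > 0" "\<And>h. 0 < h \<Longrightarrow> s + h \<in> {0..T} \<Longrightarrow> h < d \<Longrightarrow> f m s < f m (s + h)"
    using has_real_derivative_pos_inc_right[OF der[OF m s0T]] by blast
  \<comment> \<open>Halving \<open>d\<close> keeps \<open>h < d\<close> strict, and the cap
    \<open>T - s\<close> keeps \<open>s + h\<close> in the interval.\<close>
  define h where "h = min (d / 2) (T - s)"
  have "0 < h" "h < d" "s + h \<in> {0..T}" using d(1) sT s0T by (auto simp: h_def min_def)
  with d(2)[of h] below[OF m, of "s + h"] fm show False by auto
qed

section \<open>Signs and geometric decay for the infinite system\<close>

text \<open>The square has in addition the pairs with \<open>i + j > n\<close>. Both indices are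
  then at least 1, so these are products of two nonpositive numbers. This yields a differential
  inequality for truncated generating functions, with no question of convergence.\<close>

lemma sum_convolution_le_square:
  fixes a :: "nat \<Rightarrow> real"
  assumes "\<And>i. i \<ge> 1 \<Longrightarrow> a i \<le> 0"
  shows "(\<Sum>i\<le>n. \<Sum>j\<le>i. a j * a (i - j)) \<le> (\<Sum>i\<le>n. a i)\<^sup>2"
proof -
  have "(\<Sum>i\<le>n. \<Sum>j\<le>i. a j * a (i - j)) = (\<Sum>(i,j)\<in>{(i,j). i + j \<le> n}. a i * a j)"
    by (rule sum.triangle_reindex_eq[symmetric])
  also have "\<dots> \<le> (\<Sum>(i,j)\<in>{..n} \<times> {..n}. a i * a j)"
  proof (rule sum_mono2)
    fix p assume "p \<in> {..n} \<times> {..n} - {(i, j). i + j \<le> n}"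
    then have "fst p \<ge> 1" "snd p \<ge> 1" by auto
    then show "0 \<le> (case p of (i, j) \<Rightarrow> a i * a j)"
      using assms by (auto simp: case_prod_beta intro: mult_nonpos_nonpos)
  qed auto
  also have "\<dots> = (\<Sum>i\<le>n. a i)\<^sup>2"
    by (simp add: power2_eq_square sum_product sum.cartesian_product)
  finally show ?thesis .
qed

lemma infinite_riccati_deriv:
  assumes "infinite_riccati_solution \<epsilon> c T \<psi>" "t \<in> {0..T}"
  shows "(\<psi> i has_real_derivative (\<Sum>j\<le>i. \<psi> j t * \<psi> (i - j) t) - eps_seq \<epsilon> i) (at t within {0..T})"
  using assms by (simp add: infinite_riccati_solution_def atLeast0AtMost)

text \<open>At a zero of \<open>\<psi> 0\<close> the derivative is \<open>- \<epsilon> < 0\<close>,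
  so going backwards from \<open>c > 0\<close> no zero can be reached.\<close>

lemma infinite_riccati_zeroth_pos:
  assumes sol: "infinite_riccati_solution \<epsilon> c T \<psi>" and "\<epsilon> > 0" "c > 0" "t \<in> {0..T}"
  shows "\<psi> 0 t > 0"
proof -
  have "- \<psi> 0 t < 0"
  proof (rule backward_barrier[where I = "{()}" and f = "\<lambda>_ t. - \<psi> 0 t"])
    show "((\<lambda>t. - \<psi> 0 t) has_real_derivative - ((\<psi> 0 s)\<^sup>2 - \<epsilon>)) (at s within {0..T})"
      if "s \<in> {0..T}" for s
      using infinite_riccati_deriv[OF sol that, of 0]
      by (auto intro!: derivative_eq_intros simp: eps_seq_def power2_eq_square)
  qed (use sol assms in \<open>auto simp: infinite_riccati_solution_def\<close>)
  then show ?thesis by simp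
qed

text \<open>Strong induction on \<open>i\<close>: where \<open>\<psi> i\<close> is positive and the
  intermediate components are nonpositive, every term of the convolution is nonnegative, and so is
  \<open>- eps_seq \<epsilon> i\<close>.\<close>

lemma infinite_riccati_nonpos:
  assumes sol: "infinite_riccati_solution \<epsilon> c T \<psi>" and "\<epsilon> > 0" "c > 0" "t \<in> {0..T}" "i \<ge> 1"
  shows "\<psi> i t \<le> 0"
  using \<open>i \<ge> 1\<close> \<open>t \<in> {0..T}\<close>
proof (induction i arbitrary: t rule: less_induct)
  case (less i)
  \<comment> \<open>The terminal value may be 0 and the right-hand side is only nonnegative; the
    barrier \<open>\<delta> * exp (T - t)\<close> supplies the strictness that
    \<open>backward_barrier\<close> demands.\<close>
  have "\<psi> i t < \<delta> * exp (T - t)" if "\<delta> > 0" for \<delta>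
  proof -
    have "\<psi> i t - \<delta> * exp (T - t) < 0"
    proof (rule backward_barrier[where I = "{()}" and f = "\<lambda>_ t. \<psi> i t - \<delta> * exp (T - t)"
          and f' = "\<lambda>_ t. (\<Sum>j\<le>i. \<psi> j t * \<psi> (i - j) t) - eps_seq \<epsilon> i + \<delta> * exp (T - t)"])
      fix s assume s: "s \<in> {0..T}"
      show "((\<lambda>t. \<psi> i t - \<delta> * exp (T - t)) has_real_derivative
          (\<Sum>j\<le>i. \<psi> j s * \<psi> (i - j) s) - eps_seq \<epsilon> i + \<delta> * exp (T - s)) (at s within {0..T})"
        using infinite_riccati_deriv[OF sol s, of i] by (auto intro!: derivative_eq_intros)
      assume eq: "\<psi> i s - \<delta> * exp (T - s) = 0"
      then have pos: "\<psi> i s > 0" using \<open>\<delta> > 0\<close> by (simp add: algebra_simps)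
      have p0: "\<psi> 0 s > 0" using infinite_riccati_zeroth_pos[OF sol assms(2,3) s] .
      have "0 \<le> \<psi> j s * \<psi> (i - j) s" if "j \<le> i" for j
      proof (cases "j = 0 \<or> j = i")
        case True
        then show ?thesis using pos p0 by auto
      next
        case False
        with that have "j \<ge> 1" "j < i" "i - j \<ge> 1" "i - j < i" by auto
        then show ?thesis using less.IH s by (auto intro!: mult_nonpos_nonpos)
      qed
      then have "0 \<le> (\<Sum>j\<le>i. \<psi> j s * \<psi> (i - j) s)" by (intro sum_nonneg) auto
      moreover have "eps_seq \<epsilon> i \<le> 0" using \<open>\<epsilon> > 0\<close> less.prems by (simp add: eps_seq_def)
      ultimately show "(\<Sum>j\<le>i. \<psi> j s * \<psi> (i - j) s) - eps_seq \<epsilon> i + \<delta> * exp (T - s) > 0"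
        using \<open>\<delta> > 0\<close> by (simp add: add_nonneg_pos)
    next
      have "i = 1 \<or> i \<ge> 2" using less.prems by auto
      then show "\<psi> i T - \<delta> * exp (T - T) < 0"
        using sol assms(3) \<open>\<delta> > 0\<close> by (auto simp: infinite_riccati_solution_def)
    qed (use less.prems in auto)
    then show ?thesis by simp
  qed
  note bound = this
  show ?case
  proof (rule ccontr)
    assume "\<not> \<psi> i t \<le> 0"
    \<comment> \<open>This \<open>\<delta>\<close> makes the barrier at time \<open>t\<close> equal
      to \<open>\<psi> i t\<close> itself.\<close>
    with bound[of "\<psi> i t / exp (T - t)"] show False by simp
  qed
qed

text \<open>The truncated sum \<open>y\<close> satisfies
  \<open>y' \<le> y * y + \<epsilon> * (r - 1)\<close> and \<open>y(T) = - c * (r - 1)\<close>, so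
  for \<open>r\<close> close to 1 it stays above an explicit negative exponential. The bound does
  not depend on \<open>n\<close>.\<close>

lemma infinite_riccati_weighted_sum_lower_bound:
  assumes sol: "infinite_riccati_solution \<epsilon> c T \<psi>" and pos: "\<epsilon> > 0" "c > 0" and t: "t \<in> {0..T}"
    and r: "r > 1" "4 * \<epsilon> * (r - 1) < exp (- T)" "2 * c * (r - 1) < exp (- T)" and n: "n \<ge> 1"
  shows "- 1 < (\<Sum>i\<le>n. r ^ i * \<psi> i t)"
proof -
  \<comment> \<open>With this normalisation \<open>\<eta> * exp (T - t) = exp (- t) / 2\<close> lies
    between \<open>\<eta>\<close> and \<open>1 / 2\<close> on the whole interval.\<close>
  define \<eta> where "\<eta> = exp (- T) / 2"
  have \<eta>: "\<eta> > 0" "2 * \<epsilon> * (r - 1) < \<eta>" "c * (r - 1) < \<eta>" using r by (auto simp: \<eta>_def)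
  \<comment> \<open>Both \<open>eps_seq \<epsilon>\<close> and the terminal data live on the indices
    0 and 1; \<open>n \<ge> 1\<close> ensures that the sum contains both.\<close>
  have split01: "(\<Sum>i\<le>n. r ^ i * a i) = a 0 + r * a 1" if "\<And>i. i \<ge> 2 \<Longrightarrow> a i = 0" for a :: "nat \<Rightarrow> real"
  proof -
    have "(\<Sum>i\<le>n. r ^ i * a i) = (\<Sum>i\<in>{0, 1}. r ^ i * a i)"
      by (rule sum.mono_neutral_right) (use n that in auto)
    then show ?thesis by simp
  qed
  define D where "D s = (\<Sum>i\<le>n. r ^ i * ((\<Sum>j\<le>i. \<psi> j s * \<psi> (i - j) s) - eps_seq \<epsilon> i))" for s
  have "- (\<eta> * exp (T - t)) - (\<Sum>i\<le>n. r ^ i * \<psi> i t) < 0"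
  proof (rule backward_barrier[where I = "{()}"
        and f = "\<lambda>_ t. - (\<eta> * exp (T - t)) - (\<Sum>i\<le>n. r ^ i * \<psi> i t)"
        and f' = "\<lambda>_ t. \<eta> * exp (T - t) - D t"])
    fix s assume s: "s \<in> {0..T}"
    show "((\<lambda>t. - (\<eta> * exp (T - t)) - (\<Sum>i\<le>n. r ^ i * \<psi> i t)) has_real_derivative
        \<eta> * exp (T - s) - D s) (at s within {0..T})"
      unfolding D_def using infinite_riccati_deriv[OF sol s]
      by (auto intro!: derivative_eq_intros simp: mult.commute)
    assume eq: "- (\<eta> * exp (T - s)) - (\<Sum>i\<le>n. r ^ i * \<psi> i s) = 0"
    define u where "u = \<eta> * exp (T - s)"
    have "\<eta> \<le> u" using s \<eta>(1) by (simp add: u_def)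
    have "u \<le> 1 / 2" using s by (simp add: u_def \<eta>_def mult_exp_exp)
    have "r ^ i * (\<psi> j s * \<psi> (i - j) s) = (r ^ j * \<psi> j s) * (r ^ (i - j) * \<psi> (i - j) s)"
      if "j \<le> i" for i j
      using power_add[of r j "i - j"] that by simp
    then have "D s = (\<Sum>i\<le>n. \<Sum>j\<le>i. (r ^ j * \<psi> j s) * (r ^ (i - j) * \<psi> (i - j) s))
        - (\<Sum>i\<le>n. r ^ i * eps_seq \<epsilon> i)"
      unfolding D_def right_diff_distrib sum_subtractf sum_distrib_left
      by (intro arg_cong2[where f = "(-)"] sum.cong refl) auto
    also have "(\<Sum>i\<le>n. \<Sum>j\<le>i. (r ^ j * \<psi> j s) * (r ^ (i - j) * \<psi> (i - j) s))
        \<le> (\<Sum>i\<le>n. r ^ i * \<psi> i s)\<^sup>2"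
      using infinite_riccati_nonpos[OF sol pos s] r(1)
      by (intro sum_convolution_le_square) (simp add: mult_nonneg_nonpos)
    also have "\<dots> = u\<^sup>2" using eq by (simp add: u_def power2_eq_iff)
    also have "(\<Sum>i\<le>n. r ^ i * eps_seq \<epsilon> i) = - (\<epsilon> * (r - 1))"
      by (subst split01) (auto simp: eps_seq_def algebra_simps)
    finally have "D s \<le> u * u + \<epsilon> * (r - 1)" by (simp add: power2_eq_square)
    \<comment> \<open>Half of \<open>u\<close> absorbs the square because
      \<open>u \<le> 1 / 2\<close>; the other half exceeds \<open>\<epsilon> * (r - 1)\<close>,
      which is below \<open>\<eta> / 2\<close>.\<close>
    moreover have "u * u \<le> 1 / 2 * u" using \<open>u \<le> 1 / 2\<close> \<open>\<eta> \<le> u\<close> \<eta>(1) by (intro mult_right_mono) auto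
    ultimately have "D s < u" using \<open>\<eta> \<le> u\<close> \<eta>(2) by simp
    then show "0 < \<eta> * exp (T - s) - D s" by (simp add: u_def)
  next
    have "(\<Sum>i\<le>n. r ^ i * \<psi> i T) = - (c * (r - 1))"
      using sol by (subst split01) (auto simp: infinite_riccati_solution_def algebra_simps)
    then show "- (\<eta> * exp (T - T)) - (\<Sum>i\<le>n. r ^ i * \<psi> i T) < 0" using \<eta>(3) by simp
  qed (use t in auto)
  moreover have "\<eta> * exp (T - t) \<le> 1"
    using t order_trans[of "exp (- t)" 1 2] by (simp add: \<eta>_def mult_exp_exp)
  ultimately show ?thesis by linarith
qed

text \<open>Only the zeroth term is positive, so the sum of absolute values is
  \<open>2 * \<psi> 0 t\<close> minus the signed sum, and the latter is bounded below.\<close>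

lemma infinite_riccati_geometric_decay:
  assumes sol: "infinite_riccati_solution \<epsilon> c T \<psi>" and pos: "\<epsilon> > 0" "c > 0"
  obtains r A where "r > 1" "A > 0" "\<And>n t. t \<in> {0..T} \<Longrightarrow> (\<Sum>i\<le>n. r ^ i * \<bar>\<psi> i t\<bar>) \<le> A"
proof -
  \<comment> \<open>The denominator exceeds both \<open>4 * \<epsilon>\<close> and
    \<open>2 * c\<close>, so both smallness conditions on \<open>r - 1\<close> hold.\<close>
  define r where "r = 1 + exp (- T) / (4 * \<epsilon> + 2 * c + 1)"
  have r1: "r > 1" using pos by (simp add: r_def)
  have "a * (r - 1) < exp (- T)" if "a < 4 * \<epsilon> + 2 * c + 1" for a
    using that pos by (simp add: r_def divide_less_eq)
  then have r2: "4 * \<epsilon> * (r - 1) < exp (- T)" and r3: "2 * c * (r - 1) < exp (- T)"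
    using pos by simp_all
  have lower: "- 1 < (\<Sum>i\<le>n. r ^ i * \<psi> i t)" if "t \<in> {0..T}" "n \<ge> 1" for n t
    by (rule infinite_riccati_weighted_sum_lower_bound[OF sol pos that(1) r1 r2 r3 that(2)])
  have "continuous_on {0..T} (\<psi> 0)"
    by (rule DERIV_continuous_on[OF infinite_riccati_deriv[OF sol]])
  then have "bounded (\<psi> 0 ` {0..T})"
    by (intro compact_imp_bounded compact_continuous_image) auto
  then obtain M where M: "M > 0" "\<And>t. t \<in> {0..T} \<Longrightarrow> \<bar>\<psi> 0 t\<bar> \<le> M"
    unfolding bounded_pos by auto
  have "(\<Sum>i\<le>n. r ^ i * \<bar>\<psi> i t\<bar>) \<le> 2 * M + 1" if t: "t \<in> {0..T}" for n t
  proof -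
    \<comment> \<open>The extra term makes the upper index at least 1, as the lower bound requires,
      also for \<open>n = 0\<close>.\<close>
    have "(\<Sum>i\<le>n. r ^ i * \<bar>\<psi> i t\<bar>) \<le> (\<Sum>i\<le>Suc n. r ^ i * \<bar>\<psi> i t\<bar>)"
      using r1 by simp
    also have "\<dots> = \<bar>\<psi> 0 t\<bar> + (\<Sum>i\<le>n. r ^ Suc i * \<bar>\<psi> (Suc i) t\<bar>)"
      by (subst sum.atMost_Suc_shift) simp
    also have "(\<Sum>i\<le>n. r ^ Suc i * \<bar>\<psi> (Suc i) t\<bar>) = - (\<Sum>i\<le>n. r ^ Suc i * \<psi> (Suc i) t)"
      unfolding sum_negf[symmetric]
      by (intro sum.cong refl) (simp add: abs_of_nonpos[OF infinite_riccati_nonpos[OF sol pos t]])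
    also have "(\<Sum>i\<le>n. r ^ Suc i * \<psi> (Suc i) t) = (\<Sum>i\<le>Suc n. r ^ i * \<psi> i t) - \<psi> 0 t"
      by (subst sum.atMost_Suc_shift) simp
    also have "\<bar>\<psi> 0 t\<bar> + - ((\<Sum>i\<le>Suc n. r ^ i * \<psi> i t) - \<psi> 0 t) \<le> 2 * M + 1"
      using lower[OF t, of "Suc n"] M(2)[OF t] by linarith
    finally show ?thesis .
  qed
  then show ?thesis using that[of r "2 * M + 1"] r1 M(1) by simp
qed

section \<open>Comparison of the periodic with the infinite system\<close>

text \<open>The map \<open>j\<close> to \<open>i - j\<close> modulo \<open>N\<close> is an
  involution of the residues.\<close>

lemma sum_cyclic_reflection:
  fixes g :: "nat \<Rightarrow> 'a::comm_monoid_add"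
  assumes "i < N"
  shows "(\<Sum>j<N. g (if j \<le> i then i - j else N + i - j)) = (\<Sum>j<N. g j)"
  by (rule sum.reindex_bij_witness[where i = "\<lambda>j. if j \<le> i then i - j else N + i - j"
        and j = "\<lambda>j. if j \<le> i then i - j else N + i - j"]) (use assms in auto)

text \<open>Periodicity moves the index \<open>N + i - j\<close> to its representative below
  \<open>N\<close>, so that from here on only natural indices occur.\<close>

lemma periodic_riccati_deriv:
  assumes sol: "periodic_riccati_solution N \<epsilon> c T \<phi>" and t: "t \<in> {0..T}" and i: "i < N"
  shows "(\<phi> (int i) has_real_derivative
    (\<Sum>j<N. \<phi> (int j) t * \<phi> (int (if j \<le> i then i - j else N + i - j)) t) - eps_seq \<epsilon> i)
      (at t within {0..T})"
proof -
  note system = sol[unfolded periodic_riccati_solution_def]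
  have "\<phi> (int N + int i - int j) t = \<phi> (int (if j \<le> i then i - j else N + i - j)) t" if "j < N" for j
  proof (cases "j \<le> i")
    case True
    then have shift: "int N + int i - int j = int (i - j) + int N" by simp
    have "\<phi> (int (i - j) + int N) t = \<phi> (int (i - j)) t"
      using t by (rule system[THEN conjunct1, THEN spec, THEN bspec])
    then show ?thesis unfolding shift if_P[OF True] .
  next
    case False
    then have "int N + int i - int j = int (N + i - j)" using that by simp
    then show ?thesis unfolding if_not_P[OF False] by (rule arg_cong)
  qed
  then have eq: "(\<Sum>j=0..<N. \<phi> (int j) t * \<phi> (int N + int i - int j) t) =
      (\<Sum>j<N. \<phi> (int j) t * \<phi> (int (if j \<le> i then i - j else N + i - j)) t)"
    unfolding atLeast0LessThan by (intro sum.cong refl) simp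
  have "(\<phi> (int i) has_real_derivative
      (\<Sum>j=0..<N. \<phi> (int j) t * \<phi> (int N + int i - int j) t) - eps_seq \<epsilon> i) (at t within {0..T})"
    using system[THEN conjunct2, THEN conjunct1, THEN spec, THEN mp, OF i] t by (rule bspec)
  then show ?thesis unfolding eq .
qed

text \<open>Put \<open>q = p + d\<close>. The terms linear in \<open>d\<close> cost the l1 norm of
  \<open>p\<close> twice, with a factor independent of \<open>N\<close>; the quadratic ones cost
  \<open>N * u * u\<close>. The wrapped terms of \<open>p\<close> have indices adding up to
  \<open>N + i\<close>, hence are of size \<open>r ^ (- N)\<close>.\<close>

lemma cyclic_convolution_perturbation:
  fixes p q :: "nat \<Rightarrow> real"
  assumes i: "i < N" and r: "r > 1" and A: "\<And>n. (\<Sum>j\<le>n. r ^ j * \<bar>p j\<bar>) \<le> A"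
    and u: "\<And>j. j < N \<Longrightarrow> \<bar>q j - p j\<bar> \<le> u"
  shows "\<bar>(\<Sum>j<N. q j * q (if j \<le> i then i - j else N + i - j)) - (\<Sum>j\<le>i. p j * p (i - j))\<bar>
    \<le> 2 * A * u + real N * u\<^sup>2 + real N * A\<^sup>2 / r ^ N"
proof -
  define \<sigma> where "\<sigma> j = (if j \<le> i then i - j else N + i - j)" for j
  define d where "d j = q j - p j" for j
  have \<sigma>: "\<sigma> j < N" if "j < N" for j using that i by (auto simp: \<sigma>_def)
  have u0: "0 \<le> u" using u[OF i] by linarith
  have l1: "(\<Sum>j<N. \<bar>p j\<bar>) \<le> A"
  proof -
    have "(\<Sum>j<N. \<bar>p j\<bar>) \<le> (\<Sum>j\<le>N. \<bar>p j\<bar>)" by (rule sum_mono2) auto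
    also have "\<dots> \<le> (\<Sum>j\<le>N. r ^ j * \<bar>p j\<bar>)"
    proof (rule sum_mono)
      fix j
      have "1 * \<bar>p j\<bar> \<le> r ^ j * \<bar>p j\<bar>"
        using r by (intro mult_right_mono one_le_power) auto
      then show "\<bar>p j\<bar> \<le> r ^ j * \<bar>p j\<bar>" by simp
    qed
    finally show ?thesis using A[of N] by linarith
  qed
  have pw: "r ^ j * \<bar>p j\<bar> \<le> A" for j
    using member_le_sum[of j "{..j}" "\<lambda>j. r ^ j * \<bar>p j\<bar>"] A[of j] r by simp
  have A0: "0 \<le> A" using pw[of 0] by simp
  have "(\<Sum>j<N. q j * q (\<sigma> j)) =
      (\<Sum>j<N. p j * p (\<sigma> j)) + (\<Sum>j<N. p j * d (\<sigma> j) + d j * p (\<sigma> j) + d j * d (\<sigma> j))"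
    unfolding d_def sum.distrib[symmetric] by (intro sum.cong) (auto simp: algebra_simps)
  moreover have "(\<Sum>j<N. p j * p (\<sigma> j)) =
      (\<Sum>j\<le>i. p j * p (i - j)) + (\<Sum>j\<in>{Suc i..<N}. p j * p (N + i - j))"
  proof -
    have "{..<N} = {..i} \<union> {Suc i..<N}" using i by auto
    then have "(\<Sum>j<N. p j * p (\<sigma> j)) = (\<Sum>j\<le>i. p j * p (\<sigma> j)) + (\<Sum>j\<in>{Suc i..<N}. p j * p (\<sigma> j))"
      using sum.union_disjoint[of "{..i}" "{Suc i..<N}" "\<lambda>j. p j * p (\<sigma> j)"] by force
    then show ?thesis by (simp add: \<sigma>_def)
  qed
  moreover have "\<bar>\<Sum>j\<in>{Suc i..<N}. p j * p (N + i - j)\<bar> \<le> real N * A\<^sup>2 / r ^ N"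
  proof -
    have "\<bar>\<Sum>j\<in>{Suc i..<N}. p j * p (N + i - j)\<bar> \<le> (\<Sum>j\<in>{Suc i..<N}. A\<^sup>2 / r ^ N)"
    proof (rule sum_abs[THEN order_trans], rule sum_mono)
      fix j assume j: "j \<in> {Suc i..<N}"
      have "r ^ N * \<bar>p j * p (N + i - j)\<bar> \<le> r ^ (N + i) * \<bar>p j * p (N + i - j)\<bar>"
        using r by (intro mult_right_mono power_increasing) auto
      also have "\<dots> = (r ^ j * \<bar>p j\<bar>) * (r ^ (N + i - j) * \<bar>p (N + i - j)\<bar>)"
        using power_add[of r j "N + i - j"] j by (simp add: abs_mult)
      also have "\<dots> \<le> A * A" using pw A0 r by (intro mult_mono) auto
      finally show "\<bar>p j * p (N + i - j)\<bar> \<le> A\<^sup>2 / r ^ N"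
        using r by (simp add: field_simps power2_eq_square)
    qed
    also have "\<dots> = real (N - Suc i) * (A\<^sup>2 / r ^ N)" by simp
    also have "\<dots> \<le> real N * (A\<^sup>2 / r ^ N)" using r by (intro mult_right_mono) auto
    finally show ?thesis by simp
  qed
  moreover have "\<bar>\<Sum>j<N. p j * d (\<sigma> j) + d j * p (\<sigma> j) + d j * d (\<sigma> j)\<bar>
      \<le> 2 * A * u + real N * u\<^sup>2"
  proof -
    have "\<bar>\<Sum>j<N. p j * d (\<sigma> j) + d j * p (\<sigma> j) + d j * d (\<sigma> j)\<bar>
        \<le> (\<Sum>j<N. \<bar>p j\<bar> * u + u * \<bar>p (\<sigma> j)\<bar> + u * u)"
    proof (rule sum_abs[THEN order_trans], rule sum_mono)
      fix j assume "j \<in> {..<N}"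
      then have "\<bar>d j\<bar> \<le> u" "\<bar>d (\<sigma> j)\<bar> \<le> u" using u \<sigma> by (auto simp: d_def)
      then have "\<bar>p j * d (\<sigma> j)\<bar> \<le> \<bar>p j\<bar> * u" "\<bar>d j * p (\<sigma> j)\<bar> \<le> u * \<bar>p (\<sigma> j)\<bar>"
        "\<bar>d j * d (\<sigma> j)\<bar> \<le> u * u"
        unfolding abs_mult using u0 by (auto intro!: mult_mono)
      then show "\<bar>p j * d (\<sigma> j) + d j * p (\<sigma> j) + d j * d (\<sigma> j)\<bar>
          \<le> \<bar>p j\<bar> * u + u * \<bar>p (\<sigma> j)\<bar> + u * u" by linarith
    qed
    \<comment> \<open>Reflection turns the sum of \<open>\<bar>p (\<sigma> j)\<bar>\<close> into
      that of \<open>\<bar>p j\<bar>\<close>.\<close>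
    also have "\<dots> = 2 * (\<Sum>j<N. \<bar>p j\<bar>) * u + real N * u\<^sup>2"
      using sum_cyclic_reflection[OF i, of "\<lambda>j. \<bar>p j\<bar>"]
      by (simp add: sum.distrib \<sigma>_def power2_eq_square flip: sum_distrib_left sum_distrib_right)
    also have "\<dots> \<le> 2 * A * u + real N * u\<^sup>2"
      using l1 u0 by (simp add: mult_right_mono)
    finally show ?thesis .
  qed
  ultimately show ?thesis unfolding \<sigma>_def by linarith
qed

text \<open>The difference of the solutions vanishes at \<open>T\<close> and is trapped below the
  barrier \<open>u\<close>, which starts at \<open>1 / N^2\<close> and by \<open>N_exp\<close> grows
  to at most \<open>1 / N\<close>.\<close>

lemma periodic_riccati_approximation:
  assumes per: "periodic_riccati_solution N \<epsilon> c T \<phi>" and inf: "infinite_riccati_solution \<epsilon> c T \<psi>"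
    and A: "A > 0" and r: "r > 1" and sum_le: "\<And>n t. t \<in> {0..T} \<Longrightarrow> (\<Sum>i\<le>n. r ^ i * \<bar>\<psi> i t\<bar>) \<le> A"
    and N: "N \<ge> 2" and N_exp: "exp ((2 * A + 2) * T) \<le> real N" and N_pow: "real N ^ 3 * A\<^sup>2 < r ^ N"
    and i: "i < N" and t: "t \<in> {0..T}"
  shows "\<bar>\<phi> (int i) t - \<psi> i t\<bar> \<le> 1 / real N"
proof -
  \<comment> \<open>The rate is \<open>2 * A\<close> for the linear part, 1 for the quadratic part
    (as \<open>N * u \<le> 1\<close>) and 1 for the wrapped terms, which \<open>N_pow\<close> puts
    below \<open>1 / N^2 \<le> u\<close>.\<close>
  define L where "L = 2 * A + 2"
  define u where "u s = exp (L * (T - s)) / (real N)\<^sup>2" for s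
  define d where "d k s = \<phi> (int k) s - \<psi> k s" for k s
  \<comment> \<open>The forcing \<open>eps_seq\<close> cancels in the difference of the two
    systems.\<close>
  define d' where "d' k s =
    (\<Sum>j<N. \<phi> (int j) s * \<phi> (int (if j \<le> k then k - j else N + k - j)) s)
      - (\<Sum>j\<le>k. \<psi> j s * \<psi> (k - j) s)" for k s
  have N0: "real N > 0" using N by simp
  have u_le: "u s \<le> 1 / real N" if "s \<in> {0..T}" for s
  proof -
    have "L * (T - s) \<le> L * T" using that A by (simp add: L_def)
    then have "exp (L * (T - s)) \<le> real N" using N_exp unfolding L_def
      by (meson exp_le_cancel_iff order_trans)
    then show ?thesis using N0 by (simp add: u_def power2_eq_square field_simps)
  qed
  have u_ge: "u s \<ge> 1 / (real N)\<^sup>2" if "s \<in> {0..T}" for s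
    using that A by (simp add: u_def L_def divide_right_mono)
  have d_deriv: "(d k has_real_derivative d' k s) (at s within {0..T})"
    if "k < N" "s \<in> {0..T}" for k s
    unfolding d_def d'_def
    using DERIV_diff[OF periodic_riccati_deriv[OF per that(2,1)] infinite_riccati_deriv[OF inf that(2), of k]]
    by simp
  have dT: "d k T = 0" if "k < N" for k
  proof -
    have "k = 0 \<or> k = 1 \<or> k \<ge> 2" by linarith
    then show ?thesis using per inf that
      by (auto simp: d_def periodic_riccati_solution_def infinite_riccati_solution_def)
  qed
  have d'_bound: "\<bar>d' k s\<bar> < L * u s"
    if k: "k < N" and s: "s \<in> {0..T}" and le: "\<And>j. j < N \<Longrightarrow> \<bar>d j s\<bar> \<le> u s" for k s
  proof -
    have us: "u s > 0" using N0 by (simp add: u_def)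
    have "\<bar>d' k s\<bar> \<le> 2 * A * u s + real N * (u s)\<^sup>2 + real N * A\<^sup>2 / r ^ N"
      unfolding d'_def using cyclic_convolution_perturbation[OF k r, where p = "\<lambda>j. \<psi> j s"
        and q = "\<lambda>j. \<phi> (int j) s", OF sum_le[OF s], of "u s"] le
      by (simp add: d_def)
    moreover have "real N * (u s)\<^sup>2 \<le> u s"
    proof -
      have "real N * u s \<le> 1" using u_le[OF s] N0 by (simp add: field_simps)
      then have "real N * u s * u s \<le> 1 * u s" using us by (intro mult_right_mono) auto
      then show ?thesis by (simp add: power2_eq_square mult.assoc)
    qed
    moreover have "real N * A\<^sup>2 / r ^ N < 1 / (real N)\<^sup>2"
      using N_pow N0 r by (simp add: field_simps power2_eq_square power3_eq_cube)
    ultimately show ?thesis using u_ge[OF s] by (simp add: L_def algebra_simps)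
  qed
  \<comment> \<open>Pairing each index with a sign expresses \<open>\<bar>d k s\<bar> < u s\<close>
    for all \<open>k < N\<close> as one finite family of one-sided barriers. All must be treated
    together, since the bound on \<open>d' k\<close> needs every component to be at most
    \<open>u\<close>.\<close>
  have signed: "fst p * d (snd p) s - u s < 0"
    if "p \<in> {-1, 1} \<times> {..<N}" "s \<in> {0..T}" for p s
  proof (rule backward_barrier[where I = "{-1, 1} \<times> {..<N}" and f = "\<lambda>p s. fst p * d (snd p) s - u s"
        and f' = "\<lambda>p s. fst p * d' (snd p) s + L * u s"])
    fix p :: "real \<times> nat" and s assume p: "p \<in> {-1, 1} \<times> {..<N}" and s: "s \<in> {0..T}"
    then have k: "snd p < N" by auto
    have "((\<lambda>s. exp (L * (T - s))) has_real_derivative - (L * exp (L * (T - s)))) (at s within {0..T})"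
      by (auto intro!: derivative_eq_intros)
    from DERIV_cdivide[OF this, of "(real N)\<^sup>2"]
    have "(u has_real_derivative - (L * u s)) (at s within {0..T})"
      unfolding u_def by simp
    from DERIV_diff[OF DERIV_cmult[OF d_deriv[OF k s], of "fst p"] this]
    show "((\<lambda>s. fst p * d (snd p) s - u s) has_real_derivative
        fst p * d' (snd p) s + L * u s) (at s within {0..T})" by simp
    assume le: "\<And>p :: real \<times> nat. p \<in> {-1, 1} \<times> {..<N} \<Longrightarrow> fst p * d (snd p) s - u s \<le> 0"
    have "\<bar>d j s\<bar> \<le> u s" if "j < N" for j
      using le[of "(1, j)"] le[of "(-1, j)"] that by auto
    from d'_bound[OF k s this] p show "0 < fst p * d' (snd p) s + L * u s" by auto
  next
    fix p :: "real \<times> nat" assume "p \<in> {-1, 1} \<times> {..<N}"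
    then show "fst p * d (snd p) T - u T < 0" using dT N0 by (auto simp: u_def)
  qed (use that in auto)
  have "\<bar>d i t\<bar> < u t" using signed[of "(1, i)" t] signed[of "(-1, i)" t] i t by auto
  then show ?thesis using u_le[OF t] by (simp add: d_def)
qed

section \<open>Passage to the limit\<close>

theorem proposition3:
  fixes \<epsilon> c T :: real and K :: nat
    and \<phi> :: "nat \<Rightarrow> int \<Rightarrow> real \<Rightarrow> real"
    and \<psi> :: "nat \<Rightarrow> real \<Rightarrow> real"
  assumes "\<epsilon> > 0" and "c > 0" and "T > 0"
    and "\<And>N. N \<ge> 2 \<Longrightarrow> periodic_riccati_solution N \<epsilon> c T (\<phi> N)"
    and "infinite_riccati_solution \<epsilon> c T \<psi>"
  shows "(\<lambda>N. SUP i\<in>{0..K}. SUP t\<in>{0..T}. \<bar>\<phi> N (int i) t - \<psi> i t\<bar>) \<longlonglongrightarrow> 0"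
proof -
  obtain r A where r: "r > 1" and A: "A > 0"
    and sum_le: "\<And>n t. t \<in> {0..T} \<Longrightarrow> (\<Sum>i\<le>n. r ^ i * \<bar>\<psi> i t\<bar>) \<le> A"
    using infinite_riccati_geometric_decay[OF assms(5,1,2)] by metis
  have "\<forall>\<^sub>F N in sequentially. exp ((2 * A + 2) * T) \<le> real N" by real_asymp
  moreover have "\<forall>\<^sub>F N in sequentially. real N ^ 3 * A\<^sup>2 < r ^ N" using r A by real_asymp
  \<comment> \<open>Beyond \<open>K\<close>, all indices in \<open>{0..K}\<close> lie within one
    period.\<close>
  moreover have "\<forall>\<^sub>F N in sequentially. N \<ge> max 2 (Suc K)" by (rule eventually_ge_at_top)
  ultimately have ev: "\<forall>\<^sub>F N in sequentially.
      \<bar>SUP i\<in>{0..K}. SUP t\<in>{0..T}. \<bar>\<phi> N (int i) t - \<psi> i t\<bar>\<bar> \<le> 1 / real N"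
  proof eventually_elim
    case (elim N)
    have bound: "\<bar>\<phi> N (int i) t - \<psi> i t\<bar> \<le> 1 / real N" if "i \<in> {0..K}" "t \<in> {0..T}" for i t
      using periodic_riccati_approximation[OF assms(4,5) A r sum_le _ elim(1,2)] elim(3) that by auto
    \<comment> \<open>A real supremum is meaningful only for nonempty sets bounded above; the
      pointwise bound and \<open>T > 0\<close> provide this.\<close>
    have inner: "0 \<le> (SUP t\<in>{0..T}. \<bar>\<phi> N (int i) t - \<psi> i t\<bar>)"
        "(SUP t\<in>{0..T}. \<bar>\<phi> N (int i) t - \<psi> i t\<bar>) \<le> 1 / real N" if "i \<in> {0..K}" for i
    proof -
      show "(SUP t\<in>{0..T}. \<bar>\<phi> N (int i) t - \<psi> i t\<bar>) \<le> 1 / real N"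
        using bound[OF that] \<open>T > 0\<close> by (intro cSUP_least) auto
      have "bdd_above ((\<lambda>t. \<bar>\<phi> N (int i) t - \<psi> i t\<bar>) ` {0..T})"
        using bound[OF that] by (intro bdd_aboveI2)
      then show "0 \<le> (SUP t\<in>{0..T}. \<bar>\<phi> N (int i) t - \<psi> i t\<bar>)"
        using \<open>T > 0\<close> by (intro cSUP_upper2[where x = 0]) auto
    qed
    have "(SUP i\<in>{0..K}. SUP t\<in>{0..T}. \<bar>\<phi> N (int i) t - \<psi> i t\<bar>) \<le> 1 / real N"
      using inner(2) by (rule cSUP_least[rotated]) auto
    moreover have "0 \<le> (SUP i\<in>{0..K}. SUP t\<in>{0..T}. \<bar>\<phi> N (int i) t - \<psi> i t\<bar>)"
      using inner(1)[of 0] by (intro cSUP_upper2[where x = 0 and A = "{0..K}"] bdd_above_finite) simp_all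
    ultimately show ?case by simp
  qed
  show ?thesis
    by (rule Lim_null_comparison[OF _ lim_1_over_n]) (use ev in simp)
qed

end
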